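(* Let $a=1$ and $b=1/\sqrt[3]{2}$, let $\{a_n\}_{n\ge0}$ and $\{b_n\}_{n\ge 0}$ be the sequences defined by $a_0=a$, $b_0=b$ and $$a_{n+1}=\frac{a_n+2b_n}{3},\qquad b_{n+1}=\sqrt[3]{\frac{(a_n^2+a_nb_n+b_n^2)b_n}{3}},\qquad n=0,1,2,\ldots,$$ and let $c_n:=\sqrt[3]{a_n^3-b_n^3}$. Then $$\pi_3=\frac{2\,M_3\!\left(1,\frac{1}{\sqrt[3]{2}}\right)^2}{1-2\sum_{n=1}^\infty 3^n (a_n+c_n)c_n}.$$
   Context: $\pi_3:=2\int_0^1\frac{dt}{(1-t^3)^{1/3}}=\frac{2\pi}{3\sin(\pi/3)}=\frac{4\sqrt3\,\pi}{9}$. For $a\ge b>0$, the sequences given by $a_0=a$, $b_0=b$ and the recursion in the claim converge to the same limit as $n\to\infty$, which is denoted by $M_3(a,b)$. *)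

theory Defs
  imports "HOL-Analysis.Analysis"
begin

(* The integrand is unbounded at t = 1. The Henstock-Kurzweil integral agrees with the
   improper Riemann integral, and the value at t = 1 (0 by convention) is irrelevant. *)
definition pi3 :: real where
  "pi3 = 2 * integral {0..1} (\<lambda>t. 1 / root 3 (1 - t ^ 3))"

fun agm3_a :: "real \<Rightarrow> real \<Rightarrow> nat \<Rightarrow> real"
  and agm3_b :: "real \<Rightarrow> real \<Rightarrow> nat \<Rightarrow> real"
where
  "agm3_a a b 0 = a"
| "agm3_a a b (Suc n) = (agm3_a a b n + 2 * agm3_b a b n) / 3"
| "agm3_b a b 0 = b"
| "agm3_b a b (Suc n) =
     root 3 (((agm3_a a b n)^2 + agm3_a a b n * agm3_b a b n + (agm3_b a b n)^2)
             * agm3_b a b n / 3)"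

definition agm3_c :: "real \<Rightarrow> real \<Rightarrow> nat \<Rightarrow> real" where
  "agm3_c a b n = root 3 ((agm3_a a b n)^3 - (agm3_b a b n)^3)"

(* Meaningful for a \<ge> b > 0, where both sequences converge to the same limit. *)
definition M3 :: "real \<Rightarrow> real \<Rightarrow> real" where
  "M3 a b = (THE L. agm3_a a b \<longlonglongrightarrow> L \<and> agm3_b a b \<longlonglongrightarrow> L)"

end

(* Let F(x) = 2F1(1/3,2/3;1;x). On (0,1], s |-> F(1 - s^3) and
   s |-> 3/(1+2s) F(((1-s)/(1+2s))^3) solve the same second-order equation, which is singular
   but regular at s = 1, so they coincide. Hence a_n / F(1 - (b_n/a_n)^3) does not depend on n, and
   M_3(a,b) = a / F(1 - (b/a)^3). Logarithmic differentiation of the transformation shows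
   that V_n = c_n^3/a_n - 3 c_n^3 b_n^3/a_n^4 (F'/F)(c_n^3/a_n^3) satisfies
   V_n - 3 V_{n+1} = 3 (a_{n+1} + c_{n+1}) c_{n+1}, so the series telescopes to V_0.
   For b/a = 2^{-1/3} the argument is 1/2, and 1 - 2 V_0 = (3/2) F'(1/2)/F(1/2). It remains to
   know F(1/2) F'(1/2), which is a Legendre relation: the Wronskian of F(x) and F(1-x) times
   x(1-x) is constant, and its value comes from the growth of F'(x) as x -> 1. *)

theory Submission
  imports Defs
begin

section \<open>Two analytic tools: an Abelian limit theorem and constancy of Wronskians\<close>

text \<open>After subtracting \<open>L\<close>, the terms from index \<open>N\<close> on are
  dominated by e/2 times a geometric series, whose sum 1 / (1 - x) the prefactor cancels; the
  finitely many earlier ones contribute at most \<open>(1 - x) * B\<close>, which vanishes as x ->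
  1.\<close>

lemma abel_limit:
  fixes g :: "nat \<Rightarrow> real"
  assumes lim: "g \<longlonglongrightarrow> L"
  shows "((\<lambda>x. (1 - x) * (\<Sum>n. g n * x ^ n)) \<longlongrightarrow> L) (at_left 1)"
proof (rule tendstoI)
  fix e :: real
  assume "e > 0"
  obtain N where N: "\<bar>g n - L\<bar> < e / 2" if "n \<ge> N" for n
    using lim \<open>e > 0\<close> unfolding LIMSEQ_iff real_norm_def by (meson half_gt_zero)
  define B where "B = (\<Sum>n<N. \<bar>g n - L\<bar>)"
  have "((\<lambda>x. (1 - x) * B) \<longlongrightarrow> (1 - 1) * B) (at_left (1::real))"
    by (intro tendsto_intros)
  then have small: "\<forall>\<^sub>F x in at_left (1::real). (1 - x) * B < e / 2"
    by (rule order_tendstoD) (use \<open>e > 0\<close> in simp)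
  have "\<forall>\<^sub>F x in at_left (1::real). x \<in> {0<..<1}"
    by (rule eventually_at_leftI[of 0]) auto
  with small show "\<forall>\<^sub>F x in at_left 1. dist ((1 - x) * (\<Sum>n. g n * x ^ n)) L < e"
  proof eventually_elim
    case (elim x)
    then have x: "0 < x" "x < 1" by auto
    have geo: "(\<lambda>n. x ^ n) sums (1 / (1 - x))"
      using x by (intro geometric_sums) auto
    have dom: "\<bar>(g n - L) * x ^ n\<bar> \<le> (if n < N then \<bar>g n - L\<bar> else 0) + e / 2 * x ^ n" for n
    proof (cases "n < N")
      case True
      have "\<bar>g n - L\<bar> * x ^ n \<le> \<bar>g n - L\<bar> * 1"
        using x by (intro mult_left_mono power_le_one) auto
      moreover have "0 \<le> e / 2 * x ^ n" using x \<open>e > 0\<close> by simp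
      ultimately show ?thesis using True x by (simp add: abs_mult)
    next
      case False
      then have "\<bar>g n - L\<bar> * x ^ n \<le> e / 2 * x ^ n"
        using x N[of n] by (intro mult_right_mono) auto
      then show ?thesis using False x by (simp add: abs_mult)
    qed
    have "(\<lambda>n. (if n < N then \<bar>g n - L\<bar> else 0) + e / 2 * x ^ n) sums (B + e / 2 * (1 / (1 - x)))"
      unfolding B_def
      by (intro sums_add sums_mult geo)
        (use sums_If_finite[of "\<lambda>n. n < N" "\<lambda>n. \<bar>g n - L\<bar>"] in \<open>simp add: lessThan_def\<close>)
    note bound = this
    have sm: "summable (\<lambda>n. \<bar>(g n - L) * x ^ n\<bar>)"
      by (rule summable_comparison_test'[OF sums_summable[OF bound], of 0]) (use dom in simp)
    have "\<bar>\<Sum>n. (g n - L) * x ^ n\<bar> \<le> (\<Sum>n. \<bar>(g n - L) * x ^ n\<bar>)"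
      by (rule summable_rabs[OF sm])
    also have "\<dots> \<le> B + e / 2 * (1 / (1 - x))"
      using suminf_le[OF dom sm sums_summable[OF bound]] sums_unique[OF bound] by simp
    finally have "(1 - x) * \<bar>\<Sum>n. (g n - L) * x ^ n\<bar> \<le> (1 - x) * (B + e / 2 * (1 / (1 - x)))"
      using x by (intro mult_left_mono) auto
    also have "\<dots> = (1 - x) * B + e / 2"
      using x by (simp add: field_simps)
    finally have main: "(1 - x) * \<bar>\<Sum>n. (g n - L) * x ^ n\<bar> < e"
      using elim by simp
    have "(\<lambda>n. (g n - L) * x ^ n + L * x ^ n) sums ((\<Sum>n. (g n - L) * x ^ n) + L * (1 / (1 - x)))"
      by (intro sums_add sums_mult geo summable_sums summable_rabs_cancel[OF sm])
    then have "(\<Sum>n. g n * x ^ n) = (\<Sum>n. (g n - L) * x ^ n) + L / (1 - x)"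
      by (simp add: sums_iff algebra_simps)
    then have "(1 - x) * (\<Sum>n. g n * x ^ n) - L = (1 - x) * (\<Sum>n. (g n - L) * x ^ n)"
      using x by (simp add: field_simps)
    then show ?case using main x by (simp add: dist_real_def abs_mult)
  qed
qed

text \<open>Both functions solve the self-adjoint equation (p y')' = r y, so the terms p G' H' and r
  G H occur twice with opposite signs. Keeping \<open>p\<close> as a factor leaves the rule valid at
  points where \<open>p\<close> vanishes.\<close>

lemma wronskian_derivative_zero:
  fixes p G H G' H' :: "real \<Rightarrow> real"
  assumes "(G has_real_derivative G' x) (at x)" "(H has_real_derivative H' x) (at x)"
    and "((\<lambda>x. p x * G' x) has_real_derivative r * G x) (at x)"
    and "((\<lambda>x. p x * H' x) has_real_derivative r * H x) (at x)"
  shows "((\<lambda>x. G x * (p x * H' x) - H x * (p x * G' x)) has_real_derivative 0) (at x)"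
  by (rule derivative_eq_intros assms refl)+ (simp add: algebra_simps)

section \<open>The hypergeometric series and its differential equation\<close>

text \<open>\<open>hyp\<close> is the Gauss hypergeometric function with parameters \<open>1/3, 2/3; 1\<close>.\<close>

definition hyp_coeff :: "nat \<Rightarrow> real" where
  "hyp_coeff n = pochhammer (1 / 3) n * pochhammer (2 / 3) n / (fact n)\<^sup>2"

definition hyp :: "real \<Rightarrow> real" where
  "hyp x = (\<Sum>n. hyp_coeff n * x ^ n)"

definition hyp' :: "real \<Rightarrow> real" where
  "hyp' x = (\<Sum>n. diffs hyp_coeff n * x ^ n)"

lemma hyp_coeff_0 [simp]: "hyp_coeff 0 = 1"
  by (simp add: hyp_coeff_def)

lemma hyp_coeff_Suc:
  "hyp_coeff (Suc n) = hyp_coeff n * ((real n + 1 / 3) * (real n + 2 / 3) / (real n + 1)\<^sup>2)"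
  by (simp add: hyp_coeff_def pochhammer_Suc power_mult_distrib add_ac mult_ac)

lemma hyp_coeff_pos: "hyp_coeff n > 0"
  by (simp add: hyp_coeff_def pochhammer_pos)

lemma hyp_coeff_le_1: "hyp_coeff n \<le> 1"
proof (induction n)
  case (Suc n)
  have "(real n + 1 / 3) * (real n + 2 / 3) / (real n + 1)\<^sup>2 \<le> 1"
    by (simp add: divide_le_eq_1) (simp add: power2_eq_square algebra_simps)
  then have "hyp_coeff (Suc n) \<le> hyp_coeff n * 1"
    unfolding hyp_coeff_Suc using hyp_coeff_pos[of n] by (intro mult_left_mono) auto
  with Suc show ?case by simp
qed simp

lemma summable_hyp: "\<bar>x\<bar> < 1 \<Longrightarrow> summable (\<lambda>n. hyp_coeff n * x ^ n)"
proof (rule summable_comparison_test'[of "\<lambda>n. \<bar>x\<bar> ^ n" 0])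
  show "\<bar>x\<bar> < 1 \<Longrightarrow> summable (\<lambda>n. \<bar>x\<bar> ^ n)" by (simp add: summable_geometric)
  show "norm (hyp_coeff n * x ^ n) \<le> \<bar>x\<bar> ^ n" for n
    using hyp_coeff_pos[of n] hyp_coeff_le_1[of n]
    by (simp add: abs_mult power_abs mult_left_le_one_le)
qed

lemma hyp_deriv: "\<bar>x\<bar> < 1 \<Longrightarrow> (hyp has_real_derivative hyp' x) (at x)"
  unfolding hyp_def hyp'_def
  using termdiffs_strong'[of 1 hyp_coeff x] summable_hyp by simp

text \<open>A chain rule with free derivative \<open>D\<close>, shaped to be mixed with
  \<open>derivative_eq_intros\<close>.\<close>

lemma hyp_deriv':
  assumes "(g has_real_derivative g') (at x within S)" "\<bar>g x\<bar> < 1" "hyp' (g x) * g' = D"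
  shows "((\<lambda>x. hyp (g x)) has_real_derivative D) (at x within S)"
  using DERIV_chain2[OF hyp_deriv assms(1)] assms by simp

lemma hyp'_0 [simp]: "hyp' 0 = 2 / 9"
  unfolding hyp'_def powser_zero by (simp add: diffs_def hyp_coeff_Suc)

lemma hyp_0 [simp]: "hyp 0 = 1"
  by (simp add: hyp_def)

text \<open>All coefficients are positive, so the sum is at least its constant term. This justifies
  every later division by \<open>hyp\<close>.\<close>

lemma hyp_ge_1:
  assumes "0 \<le> x" "x < 1" shows "hyp x \<ge> 1"
proof -
  have "(\<Sum>n\<in>{0}. hyp_coeff n * x ^ n) \<le> hyp x"
    unfolding hyp_def using assms less_imp_le[OF hyp_coeff_pos]
    by (intro sum_le_suminf summable_hyp) (auto intro: less_imp_le)
  then show ?thesis by simp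
qed

lemma summable_hyp': "\<bar>x\<bar> < 1 \<Longrightarrow> summable (\<lambda>n. diffs hyp_coeff n * x ^ n)"
  using termdiff_converges[of x 1 hyp_coeff] summable_hyp by simp

lemma isCont_hyp': "\<bar>x\<bar> < 1 \<Longrightarrow> isCont hyp' x"
  unfolding hyp'_def
  using termdiffs_strong'[of 1 "diffs hyp_coeff" x, THEN DERIV_isCont] summable_hyp' by simp

text \<open>The Euler operator x d/dx multiplies the n-th coefficient by n.\<close>

lemma theta_hyp_sums:
  assumes "\<bar>x\<bar> < 1"
  shows "(\<lambda>n. (real n * hyp_coeff n) * x ^ n) sums (x * hyp' x)"
proof -
  have "(\<lambda>n. x * (diffs hyp_coeff n * x ^ n)) sums (x * hyp' x)"
    unfolding hyp'_def by (intro sums_mult summable_sums summable_hyp' assms)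
  then have "(\<lambda>n. (real (Suc n) * hyp_coeff (Suc n)) * x ^ Suc n) sums (x * hyp' x)"
    by (simp add: diffs_def mult_ac)
  then show ?thesis
    by (subst (asm) sums_Suc_iff) simp
qed

text \<open>The p y' of the hypergeometric equation in its self-adjoint form (x (1 - x) y')' = (2/9)
  y, where 2/9 = 1/3 * 2/3.\<close>

definition hyp_flux :: "real \<Rightarrow> real" where
  "hyp_flux x = x * (1 - x) * hyp' x"

text \<open>With h_n = \<open>hyp_coeff n\<close>, the recurrence gives (n + 1) h_(n+1) - n h_n =
  (2/9) h_n / (n + 1). Hence the series of the flux, with coefficients \<open>e\<close>, is the
  termwise antiderivative of (2/9) \<open>hyp\<close>.\<close>

lemma hyp_ode:
  assumes "\<bar>x\<bar> < 1"
  shows "(hyp_flux has_real_derivative 2 / 9 * hyp x) (at x)"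
proof -
  define e where "e n = (case n of 0 \<Rightarrow> 0 | Suc m \<Rightarrow> 2 / 9 * hyp_coeff m / real (Suc m))" for n
  have sums: "(\<lambda>n. e n * y ^ n) sums (y * (1 - y) * hyp' y)" if "\<bar>y\<bar> < 1" for y
  proof -
    note th = theta_hyp_sums[OF that]
    have "(\<lambda>n. (real (Suc n) * hyp_coeff (Suc n)) * y ^ Suc n) sums (y * hyp' y)"
      using th by (subst sums_Suc_iff) simp
    from sums_diff[OF this sums_mult[OF th, of y]]
    have "(\<lambda>n. e (Suc n) * y ^ Suc n) sums (y * (1 - y) * hyp' y)"
    proof (rule back_subst[of "\<lambda>f. f sums _", OF back_subst[of "\<lambda>s. _ sums s"]])
      show "(\<lambda>n. real (Suc n) * hyp_coeff (Suc n) * y ^ Suc n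
                - y * (real n * hyp_coeff n * y ^ n)) = (\<lambda>n. e (Suc n) * y ^ Suc n)"
      proof
        fix n
        have "real (Suc n) * hyp_coeff (Suc n) - real n * hyp_coeff n = e (Suc n)"
          by (simp add: e_def hyp_coeff_Suc power2_eq_square add_ac divide_simps)
            (simp add: algebra_simps)
        then have "e (Suc n) * y ^ Suc n
            = (real (Suc n) * hyp_coeff (Suc n) - real n * hyp_coeff n) * y ^ Suc n"
          by simp
        then show "real (Suc n) * hyp_coeff (Suc n) * y ^ Suc n
            - y * (real n * hyp_coeff n * y ^ n) = e (Suc n) * y ^ Suc n"
          by (simp add: algebra_simps)
      qed
    qed (simp add: algebra_simps)
    then show ?thesis by (subst (asm) sums_Suc_iff) (simp add: e_def)
  qed
  have d: "diffs e n = 2 / 9 * hyp_coeff n" for n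
    by (simp add: diffs_def e_def field_simps)
  have "((\<lambda>y. \<Sum>n. e n * y ^ n) has_real_derivative (\<Sum>n. diffs e n * x ^ n)) (at x)"
    by (rule termdiffs_strong'[of 1]) (use assms sums in \<open>auto simp: sums_iff\<close>)
  also have "(\<Sum>n. diffs e n * x ^ n) = 2 / 9 * hyp x"
    unfolding d hyp_def using suminf_mult[OF summable_hyp[OF assms], of "2 / 9"]
    by (simp add: mult_ac)
  finally show ?thesis
  proof (rule has_field_derivative_transform_within_open[of _ _ _ "{-1<..<1}"])
    show "(\<Sum>n. e n * y ^ n) = hyp_flux y" if "y \<in> {-1<..<1}" for y
      using sums[of y] that by (auto simp: sums_iff hyp_flux_def)
  qed (use assms in auto)
qed

lemma hyp_ode':
  assumes "(g has_real_derivative g') (at x within S)" "\<bar>g x\<bar> < 1" "2 / 9 * hyp (g x) * g' = D"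
  shows "((\<lambda>x. hyp_flux (g x)) has_real_derivative D) (at x within S)"
  using DERIV_chain2[OF hyp_ode assms(1)] assms by simp

section \<open>Coefficient asymptotics and the Legendre relation\<close>

text \<open>Multiply the Gauss limits for 1 / Gamma at 1/3 and 2/3: the powers n^(1/3) and n^(2/3)
  combine to n. The n-th member of \<open>rGamma_series\<close> contains a Pochhammer symbol of
  length n + 1, so the limit appears first for the shifted sequence; the factor n / (n + 1) adjusts
  the normalization.\<close>

lemma hyp_coeff_asymp:
  "(\<lambda>n. real n * hyp_coeff n) \<longlonglongrightarrow> 1 / (Gamma (1 / 3) * Gamma (2 / 3))"
proof -
  have "(\<lambda>n. rGamma_series (1 / 3 :: real) n * rGamma_series (2 / 3) n * (real n / real (Suc n)))
     \<longlonglongrightarrow> rGamma (1 / 3) * rGamma (2 / 3) * 1"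
    by (intro tendsto_mult rGamma_series_LIMSEQ LIMSEQ_n_over_Suc_n)
  also have "rGamma (1 / 3) * rGamma (2 / 3) * 1 = 1 / (Gamma (1 / 3 :: real) * Gamma (2 / 3))"
    by (simp add: rGamma_inverse_Gamma field_simps)
  finally have "(\<lambda>n. real (Suc n) * hyp_coeff (Suc n)) \<longlonglongrightarrow> 1 / (Gamma (1 / 3) * Gamma (2 / 3))"
  proof (rule Lim_transform_eventually)
    show "\<forall>\<^sub>F n in sequentially.
        rGamma_series (1 / 3 :: real) n * rGamma_series (2 / 3) n * (real n / real (Suc n))
          = real (Suc n) * hyp_coeff (Suc n)"
      using eventually_gt_at_top[of 0]
    proof eventually_elim
      case (elim n)
      have "exp (ln (real n) / 3) * exp (2 * ln (real n) / 3) = real n"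
        using elim by (simp flip: exp_add add_divide_distrib)
      moreover have "fact (Suc n) = real (Suc n) * fact n" by simp
      ultimately show ?case
        unfolding rGamma_series_def hyp_coeff_def using elim
        by (simp add: field_simps power2_eq_square del: of_nat_Suc fact_Suc)
    qed
  qed
  then show ?thesis by (subst (asm) filterlim_sequentially_Suc)
qed

lemma hyp_coeff_lim: "hyp_coeff \<longlonglongrightarrow> 0"
proof -
  have "(\<lambda>n. (real n * hyp_coeff n) * (1 / real n)) \<longlonglongrightarrow> 1 / (Gamma (1 / 3) * Gamma (2 / 3)) * 0"
    by (intro tendsto_mult hyp_coeff_asymp lim_1_over_n)
  then have "(\<lambda>n. (real n * hyp_coeff n) * (1 / real n)) \<longlonglongrightarrow> 0"
    by simp
  then show ?thesis
    by (rule Lim_transform_eventually) (use eventually_gt_at_top[of 0] in eventually_elim, simp)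
qed

text \<open>The equation is invariant under x -> 1 - x, so the Wronskian \<open>W\<close> is
  constant. Its value at 1/2 is -1/2 times the left side, and its limit at 0 is
  \<open>- C\<close>.\<close>

lemma legendre_relation:
  "hyp (1 / 2) * hyp' (1 / 2) = 2 / (Gamma (1 / 3) * Gamma (2 / 3))"
proof -
  define C :: real where "C = 1 / (Gamma (1 / 3) * Gamma (2 / 3))"
  define p :: "real \<Rightarrow> real" where "p x = x * (1 - x)" for x
  define W where "W x = hyp x * (p x * - hyp' (1 - x)) - hyp (1 - x) * (p x * hyp' x)" for x
  have "(W has_real_derivative 0) (at x)" if "x \<in> {0<..<1}" for x
    unfolding W_def
  proof (rule wronskian_derivative_zero[where G = hyp and H = "\<lambda>x. hyp (1 - x)" and r = "2 / 9"])
    have x: "\<bar>x\<bar> < 1" "\<bar>1 - x\<bar> < 1" using that by auto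
    show "(hyp has_real_derivative hyp' x) (at x)" by (rule hyp_deriv[OF x(1)])
    show "((\<lambda>x. hyp (1 - x)) has_real_derivative - hyp' (1 - x)) (at x)"
      by (rule derivative_eq_intros hyp_deriv' x refl)+ simp
    show "((\<lambda>x. p x * hyp' x) has_real_derivative 2 / 9 * hyp x) (at x)"
      using hyp_ode[OF x(1)] by (simp add: p_def hyp_flux_def [abs_def])
    have "((\<lambda>x. - hyp_flux (1 - x)) has_real_derivative
        2 / 9 * hyp (1 - x)) (at x)"
      by (rule derivative_eq_intros hyp_ode' x refl)+ simp
    then show "((\<lambda>x. p x * - hyp' (1 - x)) has_real_derivative 2 / 9 * hyp (1 - x)) (at x)"
      by (simp add: p_def hyp_flux_def mult_ac)
  qed
  then have "W constant_on {0<..<1}"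
    by (intro has_field_derivative_0_imp_constant_on) auto
  then obtain w where w: "W x = w" if "x \<in> {0<..<1}" for x
    by (auto simp: constant_on_def)
  have flip: "filterlim (\<lambda>x::real. 1 - x) (at_left 1) (at_right 0)"
    unfolding filterlim_at
    by (auto intro!: tendsto_eq_intros eventually_at_rightI[of 0 1])
  \<comment> \<open>The coefficients n h_n of x hyp'(x) tend to \<open>C\<close>, so Abel's limit
    gives the growth of \<open>hyp'\<close> at 1; the reflection \<open>flip\<close> then moves it
    to 0.\<close>
  have "((\<lambda>x. (1 - x) * (x * hyp' x)) \<longlongrightarrow> C) (at_left 1)"
    unfolding C_def
  proof (rule Lim_transform_eventually[OF abel_limit[OF hyp_coeff_asymp]])
    show "\<forall>\<^sub>F x in at_left 1. (1 - x) * (\<Sum>n. real n * hyp_coeff n * x ^ n) = (1 - x) * (x * hyp' x)"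
      by (rule eventually_at_leftI[of 0]) (use theta_hyp_sums in \<open>auto simp: sums_iff\<close>)
  qed
  from filterlim_compose[OF this flip]
  have lim1: "((\<lambda>x. p x * - hyp' (1 - x)) \<longlongrightarrow> - C) (at_right 0)"
    using tendsto_minus by (fastforce simp: p_def mult_ac)
  \<comment> \<open>The coefficients of \<open>hyp\<close> tend to 0, so any growth of
    \<open>hyp\<close> near 1 is beaten by the factor x; this removes the second term of
    \<open>W\<close>.\<close>
  have lim2: "((\<lambda>x. x * hyp (1 - x)) \<longlongrightarrow> 0) (at_right 0)"
    using filterlim_compose[OF abel_limit[OF hyp_coeff_lim] flip] by (simp add: hyp_def)
  have lim3: "(hyp \<longlongrightarrow> 1) (at_right 0)" "(hyp' \<longlongrightarrow> 2 / 9) (at_right 0)"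
    using DERIV_isCont[OF hyp_deriv, of 0] isCont_hyp'[of 0]
    by (auto simp: isCont_def intro: filterlim_mono[OF _ order_refl at_le])
  have "((\<lambda>x. hyp x * (p x * - hyp' (1 - x)) - (1 - x) * (x * hyp (1 - x)) * hyp' x)
      \<longlongrightarrow> 1 * - C - (1 - 0) * 0 * (2 / 9)) (at_right 0)"
    by (intro tendsto_intros lim1 lim2 lim3)
  then have "(W \<longlongrightarrow> - C) (at_right 0)"
    unfolding W_def p_def by (simp add: mult_ac)
  then have "((\<lambda>_. w) \<longlongrightarrow> - C) (at_right (0 :: real))"
    by (rule Lim_transform_eventually) (rule eventually_at_rightI[of 0 1], use w in auto)
  then have "w = - C"
    by (simp add: tendsto_const_iff)
  with w[of "1 / 2"] show ?thesis
    by (simp add: W_def p_def C_def)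
qed

section \<open>The constant \<open>pi3\<close> as a Beta integral\<close>

text \<open>The substitution u = t^3 turns the Beta integral B(1/3, 2/3) into three times the
  integral defining \<open>pi3\<close>, and Gamma(1/3 + 2/3) = 1.\<close>

lemma pi3_eq: "pi3 = 2 / 3 * (Gamma (1 / 3) * Gamma (2 / 3))"
proof -
  define h :: "real \<Rightarrow> real" where "h u = u powr (1 / 3 - 1) * (1 - u) powr (2 / 3 - 1)" for u
  define S :: "real set" where "S = {0<..<1}"
  have img: "(\<lambda>x. x ^ 3) ` S = S"
  proof safe
    show "x ^ 3 \<in> S" if "x \<in> S" for x :: real
      using that by (simp add: S_def power_less_one_iff)
    show "y \<in> (\<lambda>x. x ^ 3) ` S" if "y \<in> S" for y :: real
      using that by (intro image_eqI[of _ _ "root 3 y"]) (auto simp: S_def)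
  qed
  have h: "(h has_integral Gamma (1 / 3) * Gamma (2 / 3)) S"
    using has_integral_Beta_real[of "1 / 3" "2 / 3"]
    unfolding h_def S_def has_integral_Icc_iff_Ioo by (simp add: Beta_def)
  \<comment> \<open>Nonnegativity upgrades integrability to the absolute integrability that the
    change of variables requires.\<close>
  have "h absolutely_integrable_on S"
    by (rule nonnegative_absolutely_integrable_1) (use h in \<open>auto simp: h_def integrable_on_def\<close>)
  with h have "h absolutely_integrable_on (\<lambda>x. x ^ 3) ` S
      \<and> integral ((\<lambda>x. x ^ 3) ` S) h = Gamma (1 / 3) * Gamma (2 / 3)"
    by (simp add: img integral_unique)
  then have "integral S (\<lambda>x. \<bar>3 * x ^ 2\<bar> * h (x ^ 3)) = Gamma (1 / 3) * Gamma (2 / 3)"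
    by (subst (asm) has_absolute_integral_change_of_variables_1'
          [where S = S and g' = "\<lambda>x. 3 * x ^ 2", symmetric])
      (auto simp: S_def inj_on_def power_eq_iff_eq_base intro!: derivative_eq_intros)
  also have "integral S (\<lambda>x. \<bar>3 * x ^ 2\<bar> * h (x ^ 3)) = integral S (\<lambda>t. 3 * (1 / root 3 (1 - t ^ 3)))"
  proof (rule integral_cong)
    fix x assume "x \<in> S"
    then have x: "0 < x" "0 < 1 - x ^ 3" by (auto simp: S_def power_less_one_iff)
    have "(x ^ 3) powr (1 / 3 - 1) = 1 / x ^ 2"
      using x by (simp add: powr_powr powr_minus_divide flip: powr_numeral)
    moreover have "(1 - x ^ 3) powr (2 / 3 - 1) = 1 / root 3 (1 - x ^ 3)"
      using x by (simp add: root_powr_inverse powr_minus_divide)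
    ultimately show "\<bar>3 * x ^ 2\<bar> * h (x ^ 3) = 3 * (1 / root 3 (1 - x ^ 3))"
      using x by (simp add: h_def)
  qed
  also have "\<dots> = 3 * integral {0..1} (\<lambda>t. 1 / root 3 (1 - t ^ 3))"
    by (simp only: S_def integral_open_interval_real integral_mult_right)
  finally show ?thesis by (simp add: pi3_def)
qed

section \<open>The cubic transformation and its logarithmic derivative\<close>

text \<open>Both sides solve (p y')' = 2 t^2 y with p = t (1 - t^3). Their Wronskian expression is
  constant and vanishes at t = 1 together with \<open>p\<close>; hence the quotient
  \<open>H t / G t\<close> is constant on [s, 1], and it is 1 at t = 1.\<close>

lemma cubic_transformation:
  assumes "0 < s" "s \<le> 1"
  shows "hyp (1 - s ^ 3) = 3 / (1 + 2 * s) * hyp (((1 - s) / (1 + 2 * s)) ^ 3)"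
proof -
  define m u G G' H H' :: "real \<Rightarrow> real" where
    "m t = 3 / (1 + 2 * t)" and "u t = (1 - t) / (1 + 2 * t)" and
    "G t = hyp (1 - t ^ 3)" and "G' t = - 3 * t ^ 2 * hyp' (1 - t ^ 3)" and
    "H t = m t * hyp (u t ^ 3)" and
    "H' t = - 2 / 3 * m t ^ 2 * hyp (u t ^ 3) - m t ^ 3 * u t ^ 2 * hyp' (u t ^ 3)" for t
  define p :: "real \<Rightarrow> real" where "p t = t * (1 - t ^ 3)" for t
  \<comment> \<open>\<open>S\<close> extends beyond \<open>1\<close> because the Wronskian \<open>W\<close> is shown to vanish by evaluating it at \<open>1\<close>, where \<open>p\<close> vanishes.\<close>
  define S :: "real set" where "S = {0<..<5 / 4}"
  define W where "W t = G t * (p t * H' t) - H t * (p t * G' t)" for t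
  \<comment> \<open>The bound 5/4 works because (5/4)^3 = 125/64 < 2, which keeps both arguments of
    \<open>hyp\<close> inside the disc of convergence.\<close>
  have dom: "\<bar>1 - t ^ 3\<bar> < 1" "\<bar>u t ^ 3\<bar> < 1" "t > 0" if "t \<in> S" for t
  proof -
    have "t ^ 3 \<le> (5 / 4) ^ 3" using that by (intro power_mono) (auto simp: S_def)
    then show "\<bar>1 - t ^ 3\<bar> < 1" using that by (auto simp: S_def abs_less_iff power3_eq_cube)
    have "\<bar>u t\<bar> < 1" using that by (auto simp: S_def u_def abs_less_iff field_simps)
    then show "\<bar>u t ^ 3\<bar> < 1" by (simp add: power_abs power_less_one_iff)
    show "t > 0" using that by (simp add: S_def)
  qed
  have dm: "(m has_real_derivative - 2 / 3 * m t ^ 2) (at t)" if "t > 0" for t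
    unfolding m_def using that
    by (auto intro!: derivative_eq_intros simp: power2_eq_square divide_simps)
  have du: "(u has_real_derivative - (m t ^ 2) / 3) (at t)" if "t > 0" for t
    unfolding m_def u_def using that
    by (auto intro!: derivative_eq_intros simp: power2_eq_square divide_simps)
  have dG: "(G has_real_derivative G' t) (at t)" if "t \<in> S" for t
    unfolding G_def G'_def
    by (rule derivative_eq_intros hyp_deriv' dom(1)[OF that] refl)+ simp
  have dH: "(H has_real_derivative H' t) (at t)" if "t \<in> S" for t
    unfolding H_def H'_def
    by (rule derivative_eq_intros hyp_deriv' dom(2)[OF that]
          dm du dom(3)[OF that] refl)+ (simp add: power2_eq_square power3_eq_cube)
  have "(W has_real_derivative 0) (at t)" if "t \<in> S" for t
    unfolding W_def
  proof (rule wronskian_derivative_zero[where G = G and G' = G' and H = H and H' = H'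
        and p = p and x = t and r = "2 * t ^ 2", OF dG[OF that] dH[OF that]])
    have t: "t > 0" using dom(3)[OF that] .
    have "((\<lambda>t. - 3 * hyp_flux (1 - t ^ 3)) has_real_derivative 2 * t ^ 2 * G t) (at t)"
      by (rule derivative_eq_intros hyp_ode' dom(1)[OF that] refl)+ (simp add: G_def)
    then show "((\<lambda>t. p t * G' t) has_real_derivative 2 * t ^ 2 * G t) (at t)"
      by (simp add: p_def G'_def hyp_flux_def eval_nat_numeral mult_ac)
    have m: "m y * (1 + 2 * y) = 3" if "y > 0" for y
      using that by (simp add: m_def divide_simps)
    \<comment> \<open>This rests on (1 + 2 y)^3 - (1 - y)^3 = 9 y (1 + y + y^2). It lets p H' be
      written through \<open>hyp_flux\<close>, whose derivative is known, so no second derivative of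
      \<open>hyp\<close> arises.\<close>
    have q: "u y * (1 - u y ^ 3) = p y * m y ^ 4 / 9" if "y > 0" for y
      using that by (simp add: u_def p_def m_def divide_simps) algebra
    have flux: "9 * hyp_flux (u y ^ 3) = p y * m y ^ 4 * u y ^ 2 * hyp' (u y ^ 3)" if "y > 0" for y
      using q[OF that] unfolding hyp_flux_def by algebra
    have pH': "p y * H' y
        = - 2 / 3 * (p y * m y ^ 2) * hyp (u y ^ 3) - 3 * (1 + 2 * y) * hyp_flux (u y ^ 3)"
      if "y > 0" for y
      using flux[OF that] m[OF that] unfolding H'_def by algebra
    have dp: "(p has_real_derivative 1 - 4 * t ^ 3) (at t)"
      unfolding p_def by (rule derivative_eq_intros refl)+ (simp add: eval_nat_numeral algebra_simps)
    have dm2: "((\<lambda>t. m t ^ 2) has_real_derivative - 4 / 3 * m t ^ 3) (at t)"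
      by (rule derivative_eq_intros dm[OF t] refl)+ (simp add: eval_nat_numeral)
    have du3: "((\<lambda>t. u t ^ 3) has_real_derivative - (m t ^ 2 * u t ^ 2)) (at t)"
      by (rule derivative_eq_intros du[OF t] refl)+ simp
    \<comment> \<open>This is the coefficient of \<open>hyp (u t ^ 3)\<close> in the derivative of p
      H'. The terms with \<open>hyp'\<close> cancel by \<open>flux\<close>.\<close>
    have rat: "- 2 / 3 * ((1 - 4 * t ^ 3) * m t ^ 2 - 4 / 3 * p t * m t ^ 3)
        + 2 / 3 * (1 + 2 * t) * u t ^ 2 * m t ^ 2 = 2 * t ^ 2 * m t"
      using t by (simp add: u_def p_def m_def divide_simps) algebra
    have "((\<lambda>y. - 2 / 3 * (p y * m y ^ 2) * hyp (u y ^ 3) - 3 * (1 + 2 * y) * hyp_flux (u y ^ 3))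
        has_real_derivative 2 * t ^ 2 * H t) (at t)"
      by (rule hyp_ode' hyp_deriv' dp dm2 du3 dom(2)[OF that] derivative_eq_intros refl)+
        (use flux[OF t] rat in \<open>unfold H_def, algebra\<close>)
    then show "((\<lambda>t. p t * H' t) has_real_derivative 2 * t ^ 2 * H t) (at t)"
      by (rule has_field_derivative_transform_within_open[of _ _ _ "{0<..}"]) (use t pH' in auto)
  qed
  then have "W constant_on S"
    by (intro has_field_derivative_0_imp_constant_on) (auto simp: S_def)
  moreover have "W 1 = 0" "1 \<in> S" by (auto simp: W_def p_def S_def)
  ultimately have W0: "W t = 0" if "t \<in> S" for t
    using that unfolding constant_on_def by metis
  have ne: "G t \<noteq> 0" if "0 < t" "t \<le> 1" for t
    using hyp_ge_1[of "1 - t ^ 3"] that by (simp add: G_def power_le_one)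
  show ?thesis
  proof (cases "s = 1")
    case False
    have D: "((\<lambda>t. H t / G t) has_real_derivative (H' t * G t - H t * G' t) / (G t * G t)) (at t)"
      if "0 < t" "t \<le> 1" for t
    proof -
      have "t \<in> S" using that by (simp add: S_def)
      then show ?thesis by (intro DERIV_divide dH dG ne that)
    qed
    have "H 1 / G 1 = H s / G s"
    proof (rule DERIV_isconst2[of s 1])
      show "continuous_on {s..1} (\<lambda>t. H t / G t)"
        using assms by (intro continuous_at_imp_continuous_on ballI DERIV_isCont[OF D]) auto
      show "((\<lambda>t. H t / G t) has_real_derivative 0) (at t)" if "s < t" "t < 1" for t
      proof -
        have "p t * (H' t * G t - H t * G' t) = 0"
          using W0[of t] that assms by (simp add: W_def S_def algebra_simps)
        moreover have "p t \<noteq> 0" using that assms power_less_one_iff[of t 3] by (simp add: p_def)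
        ultimately show ?thesis using D[of t] that assms by simp
      qed
    qed (use assms False in auto)
    moreover have "H 1 / G 1 = 1" by (simp add: H_def G_def m_def u_def)
    ultimately have "G s = H s" using ne[of s] assms by simp
    then show ?thesis unfolding G_def H_def m_def u_def .
  qed simp
qed

text \<open>Differentiate the transformation at s, divide by -3, then divide by the transformation
  itself. For s < 1 it holds in a whole neighbourhood of s, as differentiation requires.\<close>

lemma cubic_transformation_log_deriv:
  fixes s :: real
  assumes s: "0 < s" "s < 1"
  defines "u \<equiv> (1 - s) / (1 + 2 * s)"
  shows "s ^ 2 * (hyp' (1 - s ^ 3) / hyp (1 - s ^ 3))
    = 2 / (3 * (1 + 2 * s)) + 3 * u ^ 2 / (1 + 2 * s) ^ 2 * (hyp' (u ^ 3) / hyp (u ^ 3))"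
proof -
  have u: "0 < u" "u < 1" using s by (auto simp: u_def divide_simps)
  have s3: "0 < s ^ 3" "s ^ 3 < 1" and u3: "0 < u ^ 3" "u ^ 3 < 1"
    using s u by (auto simp: power_less_one_iff)
  have du: "((\<lambda>t. (1 - t) / (1 + 2 * t)) has_real_derivative - 3 / (1 + 2 * s) ^ 2) (at s)"
    using s by (auto intro!: derivative_eq_intros simp: power2_eq_square divide_simps)
  have dm: "((\<lambda>t. 3 / (1 + 2 * t)) has_real_derivative - 6 / (1 + 2 * s) ^ 2) (at s)"
    using s by (auto intro!: derivative_eq_intros simp: power2_eq_square divide_simps)
  have d1: "((\<lambda>t. hyp (1 - t ^ 3)) has_real_derivative - 3 * s ^ 2 * hyp' (1 - s ^ 3)) (at s)"
    by (rule derivative_eq_intros hyp_deriv' refl)+ (use s3 in auto)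
  have du3: "((\<lambda>t. ((1 - t) / (1 + 2 * t)) ^ 3) has_real_derivative
      3 * u ^ 2 * (- 3 / (1 + 2 * s) ^ 2)) (at s)"
    by (rule du derivative_eq_intros refl)+ (simp add: u_def)
  have "((\<lambda>t. 3 / (1 + 2 * t) * hyp (((1 - t) / (1 + 2 * t)) ^ 3)) has_real_derivative
      - 6 / (1 + 2 * s) ^ 2 * hyp (u ^ 3)
      + hyp' (u ^ 3) * (3 * u ^ 2 * (- 3 / (1 + 2 * s) ^ 2)) * (3 / (1 + 2 * s))) (at s)"
    using DERIV_mult[OF dm hyp_deriv'[OF du3 _ refl]] u3 unfolding u_def by simp
  then have "((\<lambda>t. hyp (1 - t ^ 3)) has_real_derivative
      - 6 / (1 + 2 * s) ^ 2 * hyp (u ^ 3)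
      + hyp' (u ^ 3) * (3 * u ^ 2 * (- 3 / (1 + 2 * s) ^ 2)) * (3 / (1 + 2 * s))) (at s)"
    by (rule has_field_derivative_transform_within_open[of _ _ _ "{0<..<1}"])
      (use s cubic_transformation in auto)
  from DERIV_unique[OF d1 this]
  have eq: "- 3 * s ^ 2 * hyp' (1 - s ^ 3) = - 6 / (1 + 2 * s) ^ 2 * hyp (u ^ 3)
      + hyp' (u ^ 3) * (3 * u ^ 2 * (- 3 / (1 + 2 * s) ^ 2)) * (3 / (1 + 2 * s))" .
  define h h' d where "h = hyp (u ^ 3)" and "h' = hyp' (u ^ 3)" and "d = 1 + 2 * s"
  have "h \<ge> 1" unfolding h_def using u3 by (intro hyp_ge_1) auto
  then have h: "h \<noteq> 0" by simp
  have d: "d \<noteq> 0" using s by (simp add: d_def)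
  have "- 6 / d ^ 2 * h = - 3 * (2 / d ^ 2 * h)"
    and "h' * (3 * u ^ 2 * (- 3 / d ^ 2)) * (3 / d) = - 3 * (9 * u ^ 2 / d ^ 3 * h')"
    by (simp_all add: power2_eq_square power3_eq_cube)
  with eq have "s ^ 2 * hyp' (1 - s ^ 3) = 2 / d ^ 2 * h + 9 * u ^ 2 / d ^ 3 * h'"
    unfolding h_def[symmetric] h'_def[symmetric] d_def[symmetric] by linarith
  moreover have "hyp (1 - s ^ 3) = 3 / d * h"
    using cubic_transformation[of s] s by (simp add: h_def d_def u_def)
  ultimately have "s ^ 2 * (hyp' (1 - s ^ 3) / hyp (1 - s ^ 3))
      = (2 / d ^ 2 * h + 9 * u ^ 2 / d ^ 3 * h') / (3 / d * h)"
    by simp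
  also have "\<dots> = 2 / (3 * d) + 3 * u ^ 2 / d ^ 2 * (h' / h)"
  proof -
    have "2 / d ^ 2 * h / (3 / d * h) = 2 / (3 * d)"
      using d h by (simp add: power2_eq_square)
    moreover have "9 * u ^ 2 / d ^ 3 * h' / (3 / d * h) = 3 * u ^ 2 / d ^ 2 * (h' / h)"
      using d h by (simp add: power2_eq_square power3_eq_cube) (simp only: mult_ac)
    ultimately show ?thesis unfolding add_divide_distrib by simp
  qed
  finally show ?thesis unfolding h_def h'_def d_def .
qed

section \<open>One step of the cubic mean\<close>

text \<open>With \<open>a = a\<^sub>n\<close>, \<open>b = b\<^sub>n\<close> this is \<open>V\<^sub>n\<close> of the introduction; \<open>a\<^sup>3 - b\<^sup>3\<close> stands for \<open>c\<^sub>n\<^sup>3\<close>.\<close>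

definition agm3_defect :: "real \<Rightarrow> real \<Rightarrow> real" where
  "agm3_defect a b = (a ^ 3 - b ^ 3) / a
     - 3 * (a ^ 3 - b ^ 3) * b ^ 3 / a ^ 4 * (hyp' (1 - (b / a) ^ 3) / hyp (1 - (b / a) ^ 3))"

text \<open>The identity (a + 2 b)^3 - 9 (a^2 + a b + b^2) b = (a - b)^3 shows that one step of the
  mean acts on the modulus exactly as the cubic transformation at s = b / a.\<close>

lemma agm3_modulus:
  fixes a b b1 :: real
  assumes "0 < b" "b \<le> a" "b1 ^ 3 = (a\<^sup>2 + a * b + b\<^sup>2) * b / 3"
  shows "1 - (b1 / ((a + 2 * b) / 3)) ^ 3 = ((1 - b / a) / (1 + 2 * (b / a))) ^ 3"
proof -
  have u: "(1 - b / a) / (1 + 2 * (b / a)) = (a - b) / (a + 2 * b)"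
    using assms by (simp add: divide_simps)
  have d: "(a + 2 * b) ^ 3 - 27 * b1 ^ 3 = (a - b) ^ 3"
    unfolding assms by algebra
  have "a + 2 * b \<noteq> 0" using assms by simp
  then show ?thesis
    unfolding u power_divide d[symmetric] by (simp add: divide_simps)
qed

text \<open>The logarithmic derivative formula expresses the quotient hyp'/hyp of (a, b) through
  that of (a1, b1). With the weight 3 the latter cancels, and a rational identity in a and b
  remains.\<close>

lemma agm3_defect_step:
  fixes a b b1 :: real
  assumes ab: "0 < b" "b < a" and b1: "b1 ^ 3 = (a\<^sup>2 + a * b + b\<^sup>2) * b / 3"
  defines "a1 \<equiv> (a + 2 * b) / 3" and "c1 \<equiv> (a - b) / 3"
  shows "agm3_defect a b - 3 * agm3_defect a1 b1 = 3 * (a1 + c1) * c1"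
proof -
  define s where "s = b / a"
  define u where "u = (1 - s) / (1 + 2 * s)"
  define f f1 where "f = hyp' (1 - s ^ 3) / hyp (1 - s ^ 3)" and "f1 = hyp' (u ^ 3) / hyp (u ^ 3)"
  have s: "0 < s" "s < 1" using ab by (auto simp: s_def)
  have ne: "a \<noteq> 0" "b \<noteq> 0" "a1 \<noteq> 0" "a + 2 * b \<noteq> 0" using ab by (auto simp: a1_def)
  have "1 - s = 3 * c1 / a" and d: "1 + 2 * s = 3 * a1 / a"
    using ne by (simp_all add: s_def a1_def c1_def field_simps)
  then have u: "u = c1 / a1"
    using ne by (simp add: u_def)
  have "b ^ 2 * f = a ^ 2 * (s ^ 2 * f)"
    using ne by (simp add: s_def power_divide)
  also have "s ^ 2 * f = 2 / (3 * (1 + 2 * s)) + 3 * u ^ 2 / (1 + 2 * s) ^ 2 * f1"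
    unfolding f_def f1_def u_def by (rule cubic_transformation_log_deriv[OF s])
  also have "a ^ 2 * \<dots> = 2 * a ^ 3 / (9 * a1) + c1 ^ 2 * a ^ 4 / (3 * a1 ^ 4) * f1"
  proof -
    have "a ^ 2 * (2 / (3 * (3 * a1 / a))) = 2 * a ^ 3 / (9 * a1)"
      using ne by (simp add: power2_eq_square power3_eq_cube)
    moreover have "a ^ 2 * (3 * (c1 / a1) ^ 2 / (3 * a1 / a) ^ 2 * f1)
        = c1 ^ 2 * a ^ 4 / (3 * a1 ^ 4) * f1"
      using ne by (simp add: power_divide power2_eq_square power4_eq_xxxx) (simp only: mult_ac)
    ultimately show ?thesis unfolding u d distrib_left by simp
  qed
  finally have f: "b ^ 2 * f = 2 * a ^ 3 / (9 * a1) + c1 ^ 2 * a ^ 4 / (3 * a1 ^ 4) * f1" .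
  have mod1: "1 - (b1 / a1) ^ 3 = u ^ 3"
    unfolding a1_def u_def s_def using agm3_modulus[OF _ _ b1] ab by simp
  have cube: "a1 ^ 3 - b1 ^ 3 = c1 ^ 3"
    unfolding b1 a1_def c1_def by (simp add: power3_eq_cube power2_eq_square field_simps)
  \<comment> \<open>Since a^3 - b^3 = 3 c1 (a^2 + a b + b^2), the factor b completes
    \<open>b1 ^ 3\<close>; hence one b is split off from b^3 in \<open>V\<close>, leaving the b^2
    that \<open>f\<close> supplies.\<close>
  have cb: "(a ^ 3 - b ^ 3) * b = 9 * c1 * b1 ^ 3"
    unfolding b1 c1_def by algebra
  have V: "agm3_defect a b = (a ^ 3 - b ^ 3) / a - 3 * ((a ^ 3 - b ^ 3) * b) * (b ^ 2 * f) / a ^ 4"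
  proof -
    have "3 * d * b ^ 3 / a ^ 4 * f = 3 * (d * b) * (b ^ 2 * f) / a ^ 4" for d
      by (simp add: eval_nat_numeral mult_ac)
    then show ?thesis
      unfolding agm3_defect_def s_def[symmetric] f_def[symmetric] by (simp only:)
  qed
  have V1: "agm3_defect a1 b1 = c1 ^ 3 / a1 - 3 * c1 ^ 3 * b1 ^ 3 / a1 ^ 4 * f1"
    by (simp add: agm3_defect_def mod1 cube f1_def)
  have "3 * (9 * c1 * b1 ^ 3) * (2 * a ^ 3 / (9 * a1)) / a ^ 4 = 6 * c1 * b1 ^ 3 / (a * a1)"
    using ne by (simp add: power3_eq_cube power4_eq_xxxx) (simp only: mult_ac)
  moreover have "3 * (9 * c1 * b1 ^ 3) * (c1 ^ 2 * a ^ 4 / (3 * a1 ^ 4) * f1) / a ^ 4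
      = 9 * c1 ^ 3 * b1 ^ 3 / a1 ^ 4 * f1"
    using ne by (simp add: power2_eq_square power3_eq_cube)
  ultimately have "agm3_defect a b - 3 * agm3_defect a1 b1
      = (a ^ 3 - b ^ 3) / a - 6 * c1 * b1 ^ 3 / (a * a1) - 3 * c1 ^ 3 / a1"
    unfolding V V1 cb f distrib_left add_divide_distrib right_diff_distrib by simp
  also have "\<dots> = ((a ^ 3 - b ^ 3) * a1 - 6 * c1 * b1 ^ 3 - 3 * c1 ^ 3 * a) / (a * a1)"
    using ne by (simp add: diff_divide_distrib)
  also have "(a ^ 3 - b ^ 3) * a1 - 6 * c1 * b1 ^ 3 - 3 * c1 ^ 3 * a = 3 * (a1 + c1) * c1 * (a * a1)"
    unfolding b1 a1_def c1_def by (simp add: power3_eq_cube power2_eq_square field_simps)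
  finally show ?thesis using ne by simp
qed

text \<open>The factor 3 / (1 + 2 s) of the cubic transformation at s = b / a equals a / a1.\<close>

lemma hyp_agm3_invariant:
  fixes a b b1 :: real
  assumes ab: "0 < b" "b \<le> a" and b1: "b1 ^ 3 = (a\<^sup>2 + a * b + b\<^sup>2) * b / 3"
  defines "a1 \<equiv> (a + 2 * b) / 3"
  shows "a1 / hyp (1 - (b1 / a1) ^ 3) = a / hyp (1 - (b / a) ^ 3)"
proof -
  define h h1 where "h = hyp (1 - (b / a) ^ 3)" and "h1 = hyp (1 - (b1 / a1) ^ 3)"
  have "h = 3 / (1 + 2 * (b / a)) * h1"
    unfolding h_def h1_def a1_def agm3_modulus[OF ab b1]
    using ab by (intro cubic_transformation) auto
  moreover have "h \<ge> 1"
    unfolding h_def using ab by (intro hyp_ge_1) (auto simp: power_le_one)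
  ultimately show ?thesis
    unfolding h_def[symmetric] h1_def[symmetric] unfolding a1_def
    using ab by (auto simp: divide_simps mult_ac)
qed

section \<open>Convergence of the sequences, the value of the mean and the telescoping
  series\<close>

declare agm3_b.simps(2) [simp del]

context
  fixes a\<^sub>0 b\<^sub>0 :: real
  assumes init: "0 < b\<^sub>0" "b\<^sub>0 < a\<^sub>0"
begin

abbreviation (input) "A \<equiv> agm3_a a\<^sub>0 b\<^sub>0"
abbreviation (input) "B \<equiv> agm3_b a\<^sub>0 b\<^sub>0"
abbreviation (input) "C \<equiv> agm3_c a\<^sub>0 b\<^sub>0"

lemma agm3_b_Suc_cube: "B (Suc n) ^ 3 = ((A n)\<^sup>2 + A n * B n + (B n)\<^sup>2) * B n / 3"
  by (simp add: agm3_b.simps odd_real_root_pow)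

text \<open>By the identity behind \<open>agm3_modulus\<close> the difference is a perfect cube, so
  every c after the first is linear in the preceding a and b.\<close>

lemma agm3_cube_diff: "A (Suc n) ^ 3 - B (Suc n) ^ 3 = ((A n - B n) / 3) ^ 3"
  unfolding agm3_b_Suc_cube agm3_a.simps
  by (simp add: power3_eq_cube power2_eq_square field_simps)

lemma agm3_c_Suc: "C (Suc n) = (A n - B n) / 3"
  unfolding agm3_c_def agm3_cube_diff by (simp add: odd_real_root_power_cancel)

lemma agm3_b_le_Suc:
  assumes "0 < B n" "B n < A n"
  shows "B n \<le> B (Suc n)"
proof -
  have "B n * B n \<le> A n * A n" and "B n * B n \<le> A n * B n"
    using assms by (auto intro!: mult_mono)
  then have "2 * (B n * B n) \<le> A n * A n + A n * B n"
    by linarith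
  then have "3 * (B n)\<^sup>2 * B n \<le> ((A n)\<^sup>2 + A n * B n + (B n)\<^sup>2) * B n"
    using assms by (intro mult_right_mono) (auto simp: power2_eq_square)
  then have "B n ^ 3 \<le> ((A n)\<^sup>2 + A n * B n + (B n)\<^sup>2) * B n / 3"
    by (simp add: eval_nat_numeral)
  then have "root 3 (B n ^ 3) \<le> B (Suc n)"
    unfolding agm3_b.simps by (intro real_root_le_mono) auto
  then show ?thesis by (simp add: odd_real_root_power_cancel)
qed

lemma agm3_bounds: "b\<^sub>0 \<le> B n \<and> B n < A n"
proof (induction n)
  case (Suc n)
  have "B n \<le> B (Suc n)"
    using Suc init by (intro agm3_b_le_Suc) auto
  moreover have "0 < A (Suc n) ^ 3 - B (Suc n) ^ 3"
    unfolding agm3_cube_diff using Suc by simp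
  then have "B (Suc n) < A (Suc n)"
    by (rule power_less_imp_less_base[of _ 3, OF iffD1[OF diff_gt_0_iff_gt]]) (use Suc init in auto)
  ultimately show ?case using Suc by linarith
qed (use init in simp)

lemma agm3_pos: "0 < B n" "0 < A n" "B n < A n"
  using agm3_bounds[of n] init by auto

text \<open>As b does not decrease, the new gap is at most (a + 2 b)/3 - b = (a - b)/3.\<close>

lemma agm3_gap: "A n - B n \<le> (a\<^sub>0 - b\<^sub>0) * (1 / 3) ^ n"
proof (induction n)
  case (Suc n)
  have "A (Suc n) - B (Suc n) \<le> (A n - B n) / 3"
    using agm3_b_le_Suc[OF agm3_pos(1,3), of n] by (simp add: diff_divide_distrib add_divide_distrib)
  with Suc show ?case by simp
qed simp

lemma agm3_gap_lim: "(\<lambda>n. A n - B n) \<longlonglongrightarrow> 0"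
proof (rule tendsto_sandwich[OF _ _ tendsto_const])
  show "(\<lambda>n. (a\<^sub>0 - b\<^sub>0) * (1 / 3) ^ n) \<longlonglongrightarrow> 0"
    by (intro tendsto_mult_right_zero LIMSEQ_realpow_zero) auto
  show "\<forall>\<^sub>F n in sequentially. A n - B n \<le> (a\<^sub>0 - b\<^sub>0) * (1 / 3) ^ n"
    by (intro always_eventually allI agm3_gap)
qed (simp add: agm3_pos less_imp_le)

lemma agm3_ratio_lim: "(\<lambda>n. B n / A n) \<longlonglongrightarrow> 1"
proof -
  have "(\<lambda>n. (A n - B n) / A n) \<longlonglongrightarrow> 0"
  proof (rule tendsto_sandwich[OF _ _ tendsto_const])
    show "(\<lambda>n. (A n - B n) / b\<^sub>0) \<longlonglongrightarrow> 0"
      using tendsto_divide[OF agm3_gap_lim tendsto_const[of b\<^sub>0]] init by simp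
    show "\<forall>\<^sub>F n in sequentially. (A n - B n) / A n \<le> (A n - B n) / b\<^sub>0"
    proof (rule always_eventually, rule allI)
      show "(A n - B n) / A n \<le> (A n - B n) / b\<^sub>0" for n
        using agm3_bounds[of n] init by (intro divide_left_mono) auto
    qed
    show "\<forall>\<^sub>F n in sequentially. 0 \<le> (A n - B n) / A n"
      by (simp add: agm3_pos less_imp_le)
  qed
  from tendsto_diff[OF tendsto_const[of 1] this]
  have "(\<lambda>n. 1 - (A n - B n) / A n) \<longlonglongrightarrow> 1" by simp
  moreover have "1 - (A n - B n) / A n = B n / A n" for n
    using agm3_pos(2)[of n] by (simp add: field_simps)
  ultimately show ?thesis by (simp only:)
qed

lemma agm3_modulus_lim: "(\<lambda>n. 1 - (B n / A n) ^ 3) \<longlonglongrightarrow> 0"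
  by (rule tendsto_eq_intros agm3_ratio_lim refl)+ simp

text \<open>The invariant gives \<open>A n\<close> as \<open>L\<close> times \<open>hyp\<close> at a
  modulus tending to 0, where \<open>hyp\<close> is 1; \<open>B\<close> follows because the gap
  closes.\<close>

lemma agm3_limit:
  defines "L \<equiv> a\<^sub>0 / hyp (1 - (b\<^sub>0 / a\<^sub>0) ^ 3)"
  shows "A \<longlonglongrightarrow> L" "B \<longlonglongrightarrow> L"
proof -
  have inv: "A n / hyp (1 - (B n / A n) ^ 3) = L" for n
  proof (induction n)
    case (Suc n)
    then show ?case
      using hyp_agm3_invariant[OF _ _ agm3_b_Suc_cube[of n]] agm3_pos[of n] by simp
  qed (simp add: L_def)
  have ne: "hyp (1 - (B n / A n) ^ 3) \<noteq> 0" for n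
    using hyp_ge_1[of "1 - (B n / A n) ^ 3"] agm3_pos[of n] by (simp add: power_le_one)
  have A: "A n = L * hyp (1 - (B n / A n) ^ 3)" for n
    by (rule iffD1[OF nonzero_divide_eq_eq[OF ne] inv])
  have "(\<lambda>n. L * hyp (1 - (B n / A n) ^ 3)) \<longlonglongrightarrow> L * hyp 0"
    by (intro tendsto_mult tendsto_const isCont_tendsto_compose[OF _ agm3_modulus_lim]
        DERIV_isCont[OF hyp_deriv]) simp
  then show "A \<longlonglongrightarrow> L" unfolding A[symmetric] by simp
  from tendsto_diff[OF this agm3_gap_lim] show "B \<longlonglongrightarrow> L" by simp
qed

lemma M3_eq: "M3 a\<^sub>0 b\<^sub>0 = a\<^sub>0 / hyp (1 - (b\<^sub>0 / a\<^sub>0) ^ 3)"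
  unfolding M3_def
proof (rule the_equality)
  show "l = a\<^sub>0 / hyp (1 - (b\<^sub>0 / a\<^sub>0) ^ 3)" if "A \<longlonglongrightarrow> l \<and> B \<longlonglongrightarrow> l" for l
    using LIMSEQ_unique[OF _ agm3_limit(1)] that by simp
qed (simp add: agm3_limit)

text \<open>The squares of c decay at least like 9^(-n), which beats the weight 3^n.\<close>

lemma agm3_c_lim: "C \<longlonglongrightarrow> 0" "(\<lambda>n. 3 ^ n * (C n)\<^sup>2) \<longlonglongrightarrow> 0"
proof -
  have "(\<lambda>n. C (Suc n)) \<longlonglongrightarrow> 0"
    unfolding agm3_c_Suc by (rule tendsto_eq_intros agm3_gap_lim refl)+ simp_all
  then show "C \<longlonglongrightarrow> 0" by (rule LIMSEQ_imp_Suc)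
  have "(\<lambda>n. 3 ^ Suc n * (C (Suc n))\<^sup>2) \<longlonglongrightarrow> 0"
  proof (rule tendsto_sandwich[OF _ _ tendsto_const])
    show "(\<lambda>n. (a\<^sub>0 - b\<^sub>0)\<^sup>2 / 3 * (1 / 3) ^ n) \<longlonglongrightarrow> 0"
      by (intro tendsto_mult_right_zero LIMSEQ_realpow_zero) auto
    have "3 ^ Suc n * (C (Suc n))\<^sup>2 \<le> (a\<^sub>0 - b\<^sub>0)\<^sup>2 / 3 * (1 / 3) ^ n" for n
    proof -
      have "3 ^ Suc n * (C (Suc n))\<^sup>2 = 3 ^ n / 3 * (A n - B n)\<^sup>2"
        unfolding agm3_c_Suc by (simp add: power_divide)
      also have "\<dots> \<le> 3 ^ n / 3 * ((a\<^sub>0 - b\<^sub>0) * (1 / 3) ^ n)\<^sup>2"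
        using agm3_gap[of n] agm3_pos[of n] by (intro mult_left_mono power_mono) auto
      also have "\<dots> = (a\<^sub>0 - b\<^sub>0)\<^sup>2 / 3 * (1 / 3) ^ n"
        by (simp add: power2_eq_square field_simps)
      finally show ?thesis .
    qed
    then show "\<forall>\<^sub>F n in sequentially. 3 ^ Suc n * (C (Suc n))\<^sup>2 \<le> (a\<^sub>0 - b\<^sub>0)\<^sup>2 / 3 * (1 / 3) ^ n"
      by (intro always_eventually allI)
  qed simp
  then show "(\<lambda>n. 3 ^ n * (C n)\<^sup>2) \<longlonglongrightarrow> 0" by (rule LIMSEQ_imp_Suc)
qed

lemma agm3_c_series:
  "(\<lambda>n. 3 ^ Suc n * (A (Suc n) + C (Suc n)) * C (Suc n)) sums agm3_defect a\<^sub>0 b\<^sub>0"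
proof -
  define L where "L = a\<^sub>0 / hyp (1 - (b\<^sub>0 / a\<^sub>0) ^ 3)"
  note AB = agm3_limit[folded L_def]
  define x where "x n = 1 - (B n / A n) ^ 3" for n
  \<comment> \<open>The weight 3^n is included here, so that \<open>agm3_defect_step\<close> makes V
    n - V (Suc n) the n-th term of the series.\<close>
  define V where "V n = 3 ^ n * agm3_defect (A n) (B n)" for n
  \<comment> \<open>A nonzero limit is needed for the quotients by \<open>A n\<close> to
    converge.\<close>
  have "L \<ge> b\<^sub>0"
    using agm3_bounds by (intro LIMSEQ_le_const[OF AB(2)]) auto
  then have L: "L \<noteq> 0" using init by simp
  have cube: "A n ^ 3 - B n ^ 3 = C n ^ 3" for n
    by (simp add: agm3_c_def odd_real_root_pow)
  \<comment> \<open>Splitting off 3^n c^2, which tends to 0, leaves a convergent factor, so V tends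
    to 0.\<close>
  have V: "V n = 3 ^ n * (C n)\<^sup>2 * (C n / A n - 3 * C n * B n ^ 3 / A n ^ 4 * (hyp' (x n) / hyp (x n)))" for n
    unfolding V_def agm3_defect_def x_def[symmetric] cube
    by (simp add: power2_eq_square power3_eq_cube algebra_simps)
  have "x \<longlonglongrightarrow> 0" unfolding x_def by (rule agm3_modulus_lim)
  from isCont_tendsto_compose[OF DERIV_isCont[OF hyp_deriv] this]
    isCont_tendsto_compose[OF isCont_hyp' this]
  have h: "(\<lambda>n. hyp (x n)) \<longlonglongrightarrow> 1" "(\<lambda>n. hyp' (x n)) \<longlonglongrightarrow> 2 / 9"
    by simp_all
  have "V \<longlonglongrightarrow> 0 * (0 / L - 3 * 0 * L ^ 3 / L ^ 4 * ((2 / 9) / 1))"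
    unfolding V by (intro tendsto_intros agm3_c_lim AB h) (use L in auto)
  then have "V \<longlonglongrightarrow> 0" by simp
  from telescope_sums'[OF this] have "(\<lambda>n. V n - V (Suc n)) sums V 0" by simp
  moreover have "V n - V (Suc n) = 3 ^ Suc n * (A (Suc n) + C (Suc n)) * C (Suc n)" for n
  proof -
    have "V n - V (Suc n)
        = 3 ^ n * (agm3_defect (A n) (B n) - 3 * agm3_defect (A (Suc n)) (B (Suc n)))"
      by (simp add: V_def algebra_simps del: agm3_a.simps)
    also have "\<dots> = 3 ^ n * (3 * (A (Suc n) + C (Suc n)) * C (Suc n))"
      using agm3_defect_step[OF _ _ agm3_b_Suc_cube[of n]] agm3_pos[of n]
      unfolding agm3_c_Suc by (simp)
    finally show ?thesis by (simp add: mult_ac)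
  qed
  ultimately show ?thesis by (simp add: V_def)
qed

end

section \<open>Evaluation at the self-complementary modulus 1/2\<close>

theorem theorem1p3:
  fixes a b c :: "nat \<Rightarrow> real"
  defines "a \<equiv> agm3_a 1 (1 / root 3 2)"
    and "b \<equiv> agm3_b 1 (1 / root 3 2)"
    and "c \<equiv> agm3_c 1 (1 / root 3 2)"
  shows "summable (\<lambda>n. 3 ^ Suc n * (a (Suc n) + c (Suc n)) * c (Suc n)) \<and>
    pi3 = 2 * (M3 1 (1 / root 3 2))\<^sup>2 /
      (1 - 2 * (\<Sum>n. 3 ^ Suc n * (a (Suc n) + c (Suc n)) * c (Suc n)))"
proof
  have init: "0 < 1 / root 3 2" "1 / root 3 2 < (1 :: real)"
    by (auto simp: divide_simps)
  \<comment> \<open>The starting value is chosen so that x = 1 - x = 1/2, the point of the Legendre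
    relation.\<close>
  have half: "1 - (1 / root 3 2 / 1) ^ 3 = (1 / 2 :: real)"
    by (simp add: power_divide odd_real_root_pow)
  have sums: "(\<lambda>n. 3 ^ Suc n * (a (Suc n) + c (Suc n)) * c (Suc n)) sums
      agm3_defect 1 (1 / root 3 2)"
    unfolding a_def c_def by (rule agm3_c_series[OF init])
  then show "summable (\<lambda>n. 3 ^ Suc n * (a (Suc n) + c (Suc n)) * c (Suc n))"
    by (rule sums_summable)
  have M: "M3 1 (1 / root 3 2) = 1 / hyp (1 / 2)"
    unfolding M3_eq[OF init] half ..
  have "agm3_defect 1 (1 / root 3 2) = 1 / 2 - 3 / 4 * (hyp' (1 / 2) / hyp (1 / 2))"
    unfolding agm3_defect_def half by (simp add: power_divide odd_real_root_pow)
  then have D: "1 - 2 * (\<Sum>n. 3 ^ Suc n * (a (Suc n) + c (Suc n)) * c (Suc n))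
      = 3 / 2 * (hyp' (1 / 2) / hyp (1 / 2))"
    using sums by (simp add: sums_iff)
  define g where "g = Gamma (1 / 3) * Gamma (2 / 3 :: real)"
  have "g > 0"
    unfolding g_def by (intro mult_pos_pos Gamma_real_pos) simp_all
  moreover have legendre: "hyp (1 / 2) * hyp' (1 / 2) = 2 / g"
    unfolding g_def by (rule legendre_relation)
  ultimately have "hyp (1 / 2) * hyp' (1 / 2) \<noteq> 0" by simp
  then have ne: "hyp (1 / 2) \<noteq> 0" "hyp' (1 / 2) \<noteq> 0" by auto
  have "g = 2 / (hyp (1 / 2) * hyp' (1 / 2))"
    unfolding legendre by simp
  \<comment> \<open>With h = \<open>hyp (1 / 2)\<close> and h' = \<open>hyp' (1 / 2)\<close>, both
    sides equal 4 / (3 h h').\<close>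
  then show "pi3 = 2 * (M3 1 (1 / root 3 2))\<^sup>2 /
      (1 - 2 * (\<Sum>n. 3 ^ Suc n * (a (Suc n) + c (Suc n)) * c (Suc n)))"
    unfolding D M pi3_eq g_def[symmetric] using ne by (simp add: power2_eq_square)
qed

end
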